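(* For $n, m \in \mathbb{N}$, let $kr_5(n,m)$ be the number of partitions $\lambda_1 \le \lambda_2 \le \cdots \le \lambda_m$ of $n$ into $m$ parts, with at most one occurrence of the part $1$, and difference at least three at distance three, such that if parts at distance two differ by at most $1$, then their sum, together with the intermediate part, is $\equiv 1 \pmod{3}$. Then $$\sum_{m,n \geq 0} kr_5(n,m)\, q^n x^m = \sum_{n_1, n_2, n_3 \geq 0} \frac{ q^{ ( 9n_3^2 + 5n_3 )/2 + 2n_2^2 + n_2 + n_1^2 + 6n_3n_2 + 3n_3n_1 + 2n_2n_1 }\, (-q; q^2)_{n_2}\, x^{3n_3 + 2n_2 + n_1} }{ (q; q)_{n_1} (q^2; q^2)_{n_2} (q^3; q^3)_{n_3} }.$$
   Context: $\mathbb{N}=\{0,1,2,\dots\}$. A partition of $n$ into $m$ parts is a non-decreasing sequence $\lambda_1 \le \cdots \le \lambda_m$ of positive integers with sum $n$ (the empty partition is the unique partition of $0$, with $m=0$; it satisfies all the conditions vacuously). "Difference at least $k$ at distance $d$" means $\lambda_{j+d}-\lambda_j \ge k$ for all $1 \le j \le m-d$. The condition on parts at distance two says: for each $1\le j \le m-2$, if $\lambda_{j+2}-\lambda_j \le 1$ then $\lambda_j+\lambda_{j+1}+\lambda_{j+2}$ is in the stated residue class modulo $3$. The $q$-Pochhammer symbol is $(a;q)_n = \prod_{j=1}^{n}(1-aq^{j-1})$, with $(a;q)_0=1$. The identity is one of formal power series in $q$ and $x$. *)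

theory Defs
  imports
    "HOL-Analysis.Infinite_Sum"
    "HOL-Computational_Algebra.Formal_Power_Series"
    "HOL-Number_Theory.Cong"
begin

definition is_partition :: "nat \<Rightarrow> nat \<Rightarrow> nat list \<Rightarrow> bool" where
  "is_partition n m xs \<longleftrightarrow>
     sorted xs \<and> (\<forall>p\<in>set xs. 0 < p) \<and> sum_list xs = n \<and> length xs = m"

(* "xs!(j+d) - xs!j >= k" is written additively because subtraction on nat truncates. *)
definition diff_at_least_at_dist :: "nat \<Rightarrow> nat \<Rightarrow> nat list \<Rightarrow> bool" where
  "diff_at_least_at_dist k d xs \<longleftrightarrow>
     (\<forall>j. j + d < length xs \<longrightarrow> xs ! j + k \<le> xs ! (j + d))"

(* If parts at distance two differ by at most 1 (again written additively), then their sum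
   together with the intermediate part is congruent to r modulo s. *)
definition dist_two_sum_cong :: "nat \<Rightarrow> nat \<Rightarrow> nat list \<Rightarrow> bool" where
  "dist_two_sum_cong r s xs \<longleftrightarrow>
     (\<forall>j. j + 2 < length xs \<longrightarrow> xs ! (j + 2) \<le> xs ! j + 1 \<longrightarrow>
        [xs ! j + xs ! (j + 1) + xs ! (j + 2) = r] (mod s))"

definition kr5_partitions :: "nat \<Rightarrow> nat \<Rightarrow> nat list set" where
  "kr5_partitions n m = {xs. is_partition n m xs \<and> count_list xs 1 \<le> 1 \<and>
     diff_at_least_at_dist 3 3 xs \<and> dist_two_sum_cong 1 3 xs}"

lemma finite_kr5_partitions: "finite (kr5_partitions n m)"
proof (rule finite_subset)
  show "kr5_partitions n m \<subseteq> {xs. set xs \<subseteq> {..n} \<and> length xs = m}"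
    by (auto simp: kr5_partitions_def is_partition_def intro: member_le_sum_list)
qed (rule finite_lists_length_eq, simp)

definition kr5 :: "nat \<Rightarrow> nat \<Rightarrow> nat" where
  "kr5 n m = card (kr5_partitions n m)"

definition q_pochhammer :: "'a \<Rightarrow> 'a \<Rightarrow> nat \<Rightarrow> 'a::comm_ring_1" where
  "q_pochhammer a q n = (\<Prod>j=1..n. 1 - a * q ^ (j - 1))"

(* Power series in q and x are elements of "rat fps fps": the outer variable is x, and
   the coefficient of each power of x is a power series in q.  The library topology on this type
   is the x-adic one; only finitely many summands below contribute to each power of x. *)
abbreviation qv :: "rat fps" where "qv \<equiv> fps_X"

abbreviation xv :: "rat fps fps" where "xv \<equiv> fps_X"

definition kr5_gf :: "rat fps fps" where
  "kr5_gf = Abs_fps (\<lambda>m. Abs_fps (\<lambda>n. of_nat (kr5 n m)))"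

(* The division by 2 in the exponent is exact, and the denominator is a unit of "rat fps"
   as its constant term is 1. *)
definition kr5_summand :: "nat \<Rightarrow> nat \<Rightarrow> nat \<Rightarrow> rat fps fps" where
  "kr5_summand n1 n2 n3 =
     fps_const
       (qv ^ ((9 * n3\<^sup>2 + 5 * n3) div 2 + 2 * n2\<^sup>2 + n2 + n1\<^sup>2
              + 6 * n3 * n2 + 3 * n3 * n1 + 2 * n2 * n1)
          * q_pochhammer (- qv) (qv\<^sup>2) n2
        / (q_pochhammer qv qv n1 * q_pochhammer (qv\<^sup>2) (qv\<^sup>2) n2
           * q_pochhammer (qv ^ 3) (qv ^ 3) n3))
     * xv ^ (3 * n3 + 2 * n2 + n1)"

end

theory Submission
  imports Defs
begin

text \<open>
  Both sides, regarded as series \<open>F(x)\<close> whose coefficients are power series in \<open>q\<close>, satisfy the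
  fourth-order \<open>q\<close>-difference equation
    \<open>F(x) = (1 + x q) F(x q) + x^2 q^4 (1 + x q^3) F(x q^3) - x^4 q^11 F(x q^4)\<close>
  and have constant term \<open>1\<close>. Comparing coefficients of \<open>x^m\<close> with \<open>m > 0\<close>, the equation expresses
  \<open>1 - q^m\<close> times the \<open>m\<close>-th coefficient of \<open>F\<close> through earlier ones; as \<open>1 - q^m\<close> is not a zero
  divisor, the two series agree (\<open>functional_equation_zero\<close>).

  For the partitions, let \<open>E_k\<close> be the generating function of the partitions that satisfy the
  conditions at distances two and three and have all parts at least \<open>k\<close>, and \<open>O_k\<close> that of those
  among them in which \<open>k\<close> occurs at most once, so that \<open>O_1\<close> is the series in question. Three parts
  spanning a range of at most \<open>1\<close> must be of the form \<open>a, a, a + 1\<close>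
  (\<open>sum_close_triple_mod_3\<close>), and so splitting off the smallest part gives
    \<open>O_k = E_(k+1) + x q^k O_(k+1)\<close> and
    \<open>E_k = O_k + x^2 q^(2k) O_(k+2) + x^3 q^(3k+1) E_(k+3)\<close>.
  Adding \<open>1\<close> to every part replaces \<open>x\<close> by \<open>x q\<close>, hence \<open>O_(k+1)(x) = O_k(x q)\<close>, and eliminating \<open>E\<close>
  leaves the equation above.

  For the triple sum, let \<open>U(a, b, c)\<close> be the sum with the additional factor
  \<open>q^(a n_1 + 2 b n_2 + 3 c n_3)\<close>; replacing \<open>x\<close> by \<open>x q\<close> turns \<open>U(0, 0, 0)\<close> into \<open>U(1, 1, 1)\<close>.
  The factor \<open>1 - q^(n_1)\<close> cancels against the Pochhammer symbol in the denominator, and shifting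
  \<open>n_1\<close> by one expresses \<open>U(a, b, c) - U(a + 1, b, c)\<close> as a multiple of another such series; the same
  works for \<open>n_2\<close> and \<open>n_3\<close> (\<open>kr5_series_rel_1\<close>, \<open>kr5_series_rel_2\<close>, \<open>kr5_series_rel_3\<close>). The
  \<open>q\<close>-difference equation is a linear combination of five instances of these three relations.

  The substitution of \<open>x q^n\<close> for \<open>x\<close> never appears as an operation on power series: it is replaced
  by the families \<open>O_(n+1)\<close> and \<open>U(n, n, n)\<close>, whose \<open>m\<close>-th coefficients are \<open>q^(n m)\<close> times those
  for \<open>n = 0\<close>.
\<close>
unbundle fps_syntax

section \<open>Generating functions of sets of lists\<close>

definition list_gf :: "nat list set \<Rightarrow> rat fps fps" where
  "list_gf S = Abs_fps (\<lambda>m. Abs_fps (\<lambda>n.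
     of_nat (card {xs \<in> S. length xs = m \<and> sum_list xs = n})))"

lemma finite_lists_length_sum_eq:
  "finite {xs \<in> S. length xs = m \<and> sum_list xs = (n :: nat)}"
proof (rule finite_subset)
  show "{xs \<in> S. length xs = m \<and> sum_list xs = n} \<subseteq> {xs. set xs \<subseteq> {..n} \<and> length xs = m}"
    by (auto intro: member_le_sum_list)
qed (rule finite_lists_length_eq, simp)

lemma list_gf_Un:
  assumes "S \<inter> T = {}"
  shows "list_gf (S \<union> T) = list_gf S + list_gf T"
proof -
  have "card {xs \<in> S \<union> T. length xs = m \<and> sum_list xs = n}
      = card {xs \<in> S. length xs = m \<and> sum_list xs = n}
        + card {xs \<in> T. length xs = m \<and> sum_list xs = n}" for m n
  proof -
    have "{xs \<in> S \<union> T. length xs = m \<and> sum_list xs = n}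
        = {xs \<in> S. length xs = m \<and> sum_list xs = n} \<union> {xs \<in> T. length xs = m \<and> sum_list xs = n}"
      by blast
    thus ?thesis
      using assms
      by (simp only:) (subst card_Un_disjoint; auto intro!: finite_lists_length_sum_eq)
  qed
  thus ?thesis
    by (simp add: list_gf_def fps_eq_iff)
qed

lemma list_gf_Cons:
  "list_gf ((#) k ` S) = xv * fps_const (qv ^ k) * list_gf S"
proof (intro fps_ext)
  fix m n
  have set_eq: "{xs \<in> (#) k ` S. length xs = Suc m' \<and> sum_list xs = n}
      = (if k \<le> n then (#) k ` {xs \<in> S. length xs = m' \<and> sum_list xs = n - k} else {})" for m'
    by auto
  show "list_gf ((#) k ` S) $ m $ n = (xv * fps_const (qv ^ k) * list_gf S) $ m $ n"
  proof (cases m)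
    case 0
    have empty: "{xs \<in> (#) k ` S. length xs = 0 \<and> sum_list xs = n} = {}"
      by auto
    show ?thesis
      unfolding 0 list_gf_def by (simp only: empty fps_nth_Abs_fps) (simp add: mult.assoc)
  next
    case (Suc m')
    have "card ((#) k ` A) = card A" for A :: "nat list set"
      by (simp add: card_image)
    thus ?thesis
      unfolding Suc list_gf_def by (simp only: set_eq fps_nth_Abs_fps)
        (simp add: mult.assoc fps_X_power_mult_nth not_le)
  qed
qed

lemma list_gf_map_Suc:
  "list_gf (map Suc ` S) $ m = qv ^ m * list_gf S $ m"
proof (rule fps_ext)
  fix n
  have sum_Suc: "sum_list (map Suc xs) = sum_list xs + length xs" for xs
    by (induction xs) auto
  have "{xs \<in> map Suc ` S. length xs = m \<and> sum_list xs = n}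
      = (if m \<le> n then map Suc ` {xs \<in> S. length xs = m \<and> sum_list xs = n - m} else {})"
    by (auto simp: sum_Suc)
  moreover have "card (map Suc ` A) = card A" for A
    by (rule card_image) (simp add: inj_on_def inj_map_eq_map)
  ultimately show "list_gf (map Suc ` S) $ m $ n = (qv ^ m * list_gf S $ m) $ n"
    by (simp add: list_gf_def fps_X_power_mult_nth)
qed

section \<open>Decomposing the partitions at their smallest part\<close>

definition admissible :: "nat list \<Rightarrow> bool" where
  "admissible xs \<longleftrightarrow> sorted xs \<and> diff_at_least_at_dist 3 3 xs \<and> dist_two_sum_cong 1 3 xs"

lemma all_nat_iff_zero_Suc: "(\<forall>j. P j) \<longleftrightarrow> P 0 \<and> (\<forall>j. P (Suc j))"
  by (metis not0_implies_Suc)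

lemma diff_at_least_at_dist_Cons:
  "diff_at_least_at_dist k (Suc d) (x # xs) \<longleftrightarrow>
     (d < length xs \<longrightarrow> x + k \<le> xs ! d) \<and> diff_at_least_at_dist k (Suc d) xs"
  unfolding diff_at_least_at_dist_def by (subst all_nat_iff_zero_Suc) simp

lemma dist_two_sum_cong_Cons:
  "dist_two_sum_cong r s (x # xs) \<longleftrightarrow>
     (1 < length xs \<longrightarrow> xs ! 1 \<le> x + 1 \<longrightarrow> [x + xs ! 0 + xs ! 1 = r] (mod s))
     \<and> dist_two_sum_cong r s xs"
  unfolding dist_two_sum_cong_def by (subst all_nat_iff_zero_Suc) simp

lemma admissible_Nil [simp]: "admissible []"
  by (simp add: admissible_def diff_at_least_at_dist_def dist_two_sum_cong_def)

lemma admissible_Cons: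
  "admissible (x # xs) \<longleftrightarrow> admissible xs \<and> (\<forall>y\<in>set xs. x \<le> y)
     \<and> (2 < length xs \<longrightarrow> x + 3 \<le> xs ! 2)
     \<and> (1 < length xs \<longrightarrow> xs ! 1 \<le> x + 1 \<longrightarrow> (x + xs ! 0 + xs ! 1) mod 3 = 1)"
  using diff_at_least_at_dist_Cons[of 3 2 x xs]
  by (auto simp: admissible_def dist_two_sum_cong_Cons cong_def)

lemma admissible_map_Suc: "admissible (map Suc xs) \<longleftrightarrow> admissible xs"
proof (induction xs)
  case (Cons x xs)
  have "(Suc x + map Suc xs ! 0 + map Suc xs ! 1) mod 3 = (x + xs ! 0 + xs ! 1) mod 3"
    if "1 < length xs"
  proof -
    have "map Suc xs ! 0 = Suc (xs ! 0)" "map Suc xs ! 1 = Suc (xs ! 1)"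
      using that by (auto intro: nth_map)
    thus ?thesis
      by (simp only:) presburger
  qed
  with Cons show ?case
    by (auto simp: admissible_Cons)
qed simp

text \<open>
  This removes residues from the rest of the argument. Sorted triples with range at most \<open>1\<close> are
  \<open>a, a, a\<close>, or \<open>a, a, a + 1\<close>, or \<open>a, a + 1, a + 1\<close>, and their sums have the three different
  residues \<open>0\<close>, \<open>1\<close>, \<open>2\<close>.
\<close>
lemma sum_close_triple_mod_3:
  fixes a b c :: nat
  assumes "a \<le> b" "b \<le> c"
  shows "(c \<le> a + 1 \<longrightarrow> (a + b + c) mod 3 = 1) \<longleftrightarrow> a + 2 \<le> c \<or> b = a \<and> c = a + 1"
proof -
  have residues: "(a + a + a) mod 3 = 0" "(a + a + (a + 1)) mod 3 = 1"
    "(a + (a + 1) + (a + 1)) mod 3 = 2"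
    by presburger+
  consider "b = a" "c = a" | "b = a" "c = a + 1" | "b = a + 1" "c = a + 1" | "a + 2 \<le> c"
    using assms by linarith
  thus ?thesis
  proof cases
    case 1
    show ?thesis unfolding 1 using residues(1) by auto
  next
    case 2
    show ?thesis unfolding 2 using residues(2) by auto
  next
    case 3
    show ?thesis unfolding 3 using residues(3) by auto
  next
    case 4
    thus ?thesis by auto
  qed
qed

lemma admissible_single: "admissible [a]"
  by (simp add: admissible_Cons)

lemma admissible_pair_iff: "admissible [a, b] \<longleftrightarrow> a \<le> b"
  by (simp add: admissible_Cons)

lemma admissible_triple_iff:
  "admissible (a # b # c # xs) \<longleftrightarrow> admissible (b # c # xs) \<and> a \<le> b
     \<and> (a + 2 \<le> c \<or> b = a \<and> c = a + 1) \<and> (\<forall>d ys. xs = d # ys \<longrightarrow> a + 3 \<le> d)"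
proof (cases "admissible (b # c # xs) \<and> a \<le> b")
  case True
  hence b: "\<forall>y\<in>set (c # xs). b \<le> y"
    unfolding admissible_Cons[of b] by blast
  hence "\<forall>y\<in>set (b # c # xs). a \<le> y"
    using True by auto
  hence "admissible (a # b # c # xs) \<longleftrightarrow>
      (c \<le> a + 1 \<longrightarrow> (a + b + c) mod 3 = 1) \<and> (xs \<noteq> [] \<longrightarrow> a + 3 \<le> hd xs)"
    using True unfolding admissible_Cons[of a]
    by (cases xs) auto
  moreover have "(c \<le> a + 1 \<longrightarrow> (a + b + c) mod 3 = 1) \<longleftrightarrow> a + 2 \<le> c \<or> b = a \<and> c = a + 1"
    using True b by (intro sum_close_triple_mod_3) auto
  ultimately show ?thesis
    using True by (auto simp: neq_Nil_conv)
qed (auto simp: admissible_Cons[of a])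

lemmas admissible_iffs = admissible_single admissible_pair_iff admissible_triple_iff

definition parts_from :: "nat \<Rightarrow> nat list set" where
  "parts_from k = {xs. admissible xs \<and> (\<forall>p\<in>set xs. k \<le> p)}"

lemma Nil_in_parts_from: "[] \<in> parts_from k"
  by (simp add: parts_from_def)

lemma Cons_in_parts_from_iff: "a # xs \<in> parts_from k \<longleftrightarrow> admissible (a # xs) \<and> k \<le> a"
  by (fastforce simp: parts_from_def admissible_Cons)

text \<open>
  As the lists are sorted with entries at least \<open>k\<close>, having \<open>k\<close> at most once means that the second
  entry exceeds \<open>k\<close>.
\<close>
definition parts_from_once :: "nat \<Rightarrow> nat list set" where
  "parts_from_once k = {xs \<in> parts_from k. \<forall>a b ys. xs = a # b # ys \<longrightarrow> k < b}"

lemma kr5_gf_eq_list_gf: "kr5_gf = list_gf (parts_from_once 1)"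
proof -
  have once_iff: "count_list xs 1 \<le> 1 \<longleftrightarrow> (\<forall>a b ys. xs = a # b # ys \<longrightarrow> 1 < b)"
    if "sorted xs" "\<forall>p\<in>set xs. 0 < p" for xs :: "nat list"
  proof (cases xs)
    case (Cons a xs')
    show ?thesis
    proof (cases xs')
      case Cons': (Cons b ys)
      have "count_list ys 1 = 0" if "1 < b"
        using \<open>sorted xs\<close> that by (auto simp: Cons Cons' count_list_0_iff)
      thus ?thesis
        using that by (auto simp: Cons Cons')
    qed (simp add: Cons)
  qed simp
  have "kr5_partitions n m = {xs \<in> parts_from_once 1. length xs = m \<and> sum_list xs = n}" for n m
    using once_iff
    by (auto simp: kr5_partitions_def is_partition_def parts_from_once_def parts_from_def
        admissible_def Suc_le_eq)
  thus ?thesis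
    by (simp add: kr5_gf_def list_gf_def kr5_def)
qed

lemma parts_from_Suc: "parts_from (Suc k) = map Suc ` parts_from k"
proof (intro equalityI subsetI)
  fix xs assume xs: "xs \<in> parts_from (Suc k)"
  hence "xs = map Suc (map (\<lambda>p. p - 1) xs)"
    by (auto simp: parts_from_def intro!: map_idI[symmetric])
  moreover have "map (\<lambda>p. p - 1) xs \<in> parts_from k"
    using xs calculation admissible_map_Suc[of "map (\<lambda>p. p - 1) xs"]
    by (auto simp: parts_from_def)
  ultimately show "xs \<in> map Suc ` parts_from k"
    by blast
qed (auto simp: parts_from_def admissible_map_Suc)

lemma parts_from_once_Suc: "parts_from_once (Suc k) = map Suc ` parts_from_once k"
proof -
  have "map Suc xs \<in> parts_from_once (Suc k) \<longleftrightarrow> xs \<in> parts_from_once k"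
    if "xs \<in> parts_from k" for xs
    using that parts_from_Suc[of k]
    by (cases xs rule: remdups_adj.cases) (auto simp: parts_from_once_def Cons_eq_map_conv)
  thus ?thesis
    using parts_from_Suc[of k] by (auto simp: parts_from_once_def)
qed

text \<open>
  Prepending \<open>k\<close> rules out a repeated \<open>k + 1\<close>, because \<open>k, k + 1, k + 1\<close> is not of the form
  \<open>a, a, a + 1\<close>. Conversely, \<open>k\<close> followed by three parts from \<open>k + 1\<close> and \<open>k + 2\<close> would
  violate the difference condition at distance three, but those three parts could only be
  \<open>k + 1, k + 1, k + 2\<close>, in which \<open>k + 1\<close> is repeated.
\<close>
lemma Cons_in_parts_from_once_iff:
  "k # ys \<in> parts_from_once k \<longleftrightarrow> ys \<in> parts_from_once (Suc k)"
proof (cases ys rule: remdups_adj.cases)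
  case (3 a b zs)
  have "a \<le> b" if "admissible (a # b # zs)"
    using that by (simp add: admissible_Cons)
  moreover have "k + 3 \<le> c" if "admissible (a # b # c # ws)" "Suc k \<le> a" "Suc k < b" for c ws
  proof -
    have "b \<le> c"
      using that(1) by (simp add: admissible_Cons)
    with that show ?thesis
      by (auto simp: admissible_triple_iff)
  qed
  ultimately show ?thesis
    by (auto simp: 3 parts_from_once_def Cons_in_parts_from_iff admissible_triple_iff[of k])
qed (auto simp: parts_from_once_def Cons_in_parts_from_iff Nil_in_parts_from admissible_iffs)

lemma parts_from_once_decomp:
  "parts_from_once k = parts_from (Suc k) \<union> (#) k ` parts_from_once (Suc k)"
proof (rule set_eqI)
  fix xs
  show "xs \<in> parts_from_once k \<longleftrightarrow>
    xs \<in> parts_from (Suc k) \<union> (#) k ` parts_from_once (Suc k)"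
  proof (cases xs)
    case Nil
    thus ?thesis by (simp add: parts_from_once_def Nil_in_parts_from)
  next
    case (Cons x ys)
    show ?thesis
    proof (cases "x = k")
      case True
      have "k # ys \<notin> parts_from (Suc k)"
        by (simp add: parts_from_def)
      thus ?thesis
        unfolding Cons True by (auto simp: Cons_in_parts_from_once_iff)
    next
      case False
      have "k < b" if "x # b # zs \<in> parts_from (Suc k)" for b zs
        using that by (simp add: parts_from_def Suc_le_eq)
      with False show ?thesis
        by (auto simp: Cons parts_from_once_def Cons_in_parts_from_iff)
    qed
  qed
qed

text \<open>
  A gap of two below the smallest part suffices for both conditions: the third part of an
  admissible list exceeds the first one, since three equal parts are excluded.
\<close>
lemma admissible_Cons_gap:
  assumes "admissible (b # xs)" "a + 2 \<le> b"
  shows "admissible (a # b # xs)"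
proof (cases xs rule: remdups_adj.cases)
  case (3 c d ys)
  have "b \<le> c" "b + 1 \<le> d"
    using assms(1) by (auto simp: 3 admissible_triple_iff[of b] admissible_Cons[of c])
  thus ?thesis
    using assms by (simp add: 3 admissible_triple_iff[of a])
qed (use assms in \<open>auto simp: admissible_Cons\<close>)

text \<open>
  After \<open>k, k\<close> the second remaining part is at least \<open>k + 3\<close>. If the first one is at least \<open>k + 2\<close>,
  this says exactly that \<open>k + 2\<close> is not repeated; otherwise it is \<open>k + 1\<close>, and the other parts form
  an arbitrary admissible list with entries from \<open>k + 3\<close> on.
\<close>
lemma Cons_Cons_in_parts_from_iff:
  "k # k # ys \<in> parts_from k \<longleftrightarrow>
     ys \<in> parts_from_once (k + 2) \<or> ys \<in> (#) (k + 1) ` parts_from (k + 3)"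
proof (cases ys rule: remdups_adj.cases)
  case 1
  thus ?thesis
    by (simp add: parts_from_once_def Nil_in_parts_from Cons_in_parts_from_iff admissible_iffs)
next
  case (2 a)
  thus ?thesis
    by (auto simp: parts_from_once_def Nil_in_parts_from Cons_in_parts_from_iff admissible_iffs)
next
  case (3 a b zs)
  have third: "k + 3 \<le> c" if "admissible (a # b # c # ws)" "k + 3 \<le> b" for c ws
    using that by (simp add: admissible_triple_iff[of a] admissible_Cons[of b])
  have split: "k # k # ys \<in> parts_from k \<longleftrightarrow>
      admissible (a # b # zs) \<and> k + 1 \<le> a \<and> k + 3 \<le> b"
    using third by (auto simp: 3 Cons_in_parts_from_iff admissible_triple_iff[of k])
  also have "\<dots> \<longleftrightarrow> ys \<in> parts_from_once (k + 2) \<or> ys \<in> (#) (k + 1) ` parts_from (k + 3)"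
  proof -
    have "admissible (b # zs)" if "admissible (a # b # zs)"
      using that by (simp add: admissible_Cons[of a])
    moreover have "admissible (a # b # zs)" if "admissible (b # zs)" "a = k + 1" "k + 3 \<le> b"
      using that by (intro admissible_Cons_gap) auto
    moreover have "k + 1 \<le> a \<longleftrightarrow> a = k + 1 \<or> k + 2 \<le> a"
      by linarith
    ultimately show ?thesis
      by (auto simp: 3 parts_from_once_def Cons_in_parts_from_iff)
  qed
  finally show ?thesis .
qed

lemma parts_from_decomp:
  "parts_from k = parts_from_once k \<union> (#) k ` (#) k ` parts_from_once (k + 2)
     \<union> (#) k ` (#) k ` (#) (k + 1) ` parts_from (k + 3)"
proof (rule set_eqI)
  fix xs
  show "xs \<in> parts_from k \<longleftrightarrow> xs \<in> parts_from_once k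
     \<union> (#) k ` (#) k ` parts_from_once (k + 2) \<union> (#) k ` (#) k ` (#) (k + 1) ` parts_from (k + 3)"
  proof (cases "\<exists>ys. xs = k # k # ys")
    case True
    then obtain ys where "xs = k # k # ys" ..
    moreover have "k # k # ys \<notin> parts_from_once k"
      by (simp add: parts_from_once_def)
    ultimately show ?thesis
      using Cons_Cons_in_parts_from_iff[of k ys] by auto
  next
    case False
    have "k < b" if "a # b # ys \<in> parts_from k" "xs = a # b # ys" for a b ys
      using that False by (force simp: parts_from_def admissible_Cons)
    hence "xs \<in> parts_from k \<longleftrightarrow> xs \<in> parts_from_once k"
      by (auto simp: parts_from_once_def)
    with False show ?thesis
      by blast
  qed
qed


lemma list_gf_parts_from_once:
  "list_gf (parts_from_once (Suc k)) = list_gf (parts_from (k + 2))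
     + xv * fps_const (qv ^ Suc k) * list_gf (parts_from_once (k + 2))"
proof -
  have "list_gf (parts_from_once (Suc k)) = list_gf (parts_from (Suc (Suc k)))
     + list_gf ((#) (Suc k) ` parts_from_once (Suc (Suc k)))"
    unfolding parts_from_once_decomp[of "Suc k"]
    by (rule list_gf_Un) (auto simp: Cons_in_parts_from_iff)
  thus ?thesis
    by (simp add: list_gf_Cons)
qed

lemma list_gf_parts_from:
  "list_gf (parts_from (Suc k)) = list_gf (parts_from_once (Suc k))
     + xv ^ 2 * fps_const (qv ^ (2 * k + 2)) * list_gf (parts_from_once (k + 3))
     + xv ^ 3 * fps_const (qv ^ (3 * k + 4)) * list_gf (parts_from (k + 4))"
proof -
  let ?once = "parts_from_once (Suc k)"
    and ?two = "(#) (Suc k) ` (#) (Suc k) ` parts_from_once (Suc (k + 2))"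
    and ?three = "(#) (Suc k) ` (#) (Suc k) ` (#) (k + 2) ` parts_from (Suc (k + 3))"
  have "parts_from (Suc k) = ?once \<union> ?two \<union> ?three"
    using parts_from_decomp[of "Suc k"] by (simp add: add_ac eval_nat_numeral)
  moreover have "list_gf (?once \<union> ?two \<union> ?three) = list_gf (?once \<union> ?two) + list_gf ?three"
    by (rule list_gf_Un) (auto simp: parts_from_once_def Cons_in_parts_from_iff)
  moreover have "list_gf (?once \<union> ?two) = list_gf ?once + list_gf ?two"
    by (rule list_gf_Un) (auto simp: parts_from_once_def)
  moreover have "list_gf ?two
      = xv ^ 2 * fps_const (qv ^ (2 * k + 2)) * list_gf (parts_from_once (k + 3))"
    by (simp add: list_gf_Cons power2_eq_square mult_ac power_add eval_nat_numeral
        flip: fps_const_mult)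
  moreover have "list_gf ?three
      = xv ^ 3 * fps_const (qv ^ (3 * k + 4)) * list_gf (parts_from (k + 4))"
    by (simp add: list_gf_Cons mult_ac power_add eval_nat_numeral flip: fps_const_mult)
  ultimately show ?thesis
    by simp
qed

text \<open>
  This is the substitution \<open>O_(k+1)(x) = O_1(x q^k)\<close>: adding \<open>k\<close> to all of \<open>m\<close> parts raises their
  sum by \<open>k m\<close>.
\<close>
lemma list_gf_parts_from_once_nth:
  "list_gf (parts_from_once (Suc k)) $ m = qv ^ (k * m) * list_gf (parts_from_once 1) $ m"
proof (induction k)
  case (Suc k)
  have "list_gf (parts_from_once (Suc (Suc k))) $ m
      = qv ^ m * list_gf (parts_from_once (Suc k)) $ m"
    by (subst parts_from_once_Suc) (rule list_gf_map_Suc)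
  thus ?case
    by (simp add: Suc power_add mult_ac)
qed simp

text \<open>
  With \<open>F k\<close> standing for \<open>O_(k+1)\<close> and \<open>G k\<close> for \<open>E_(k+1)\<close>, the recursion for \<open>E_2\<close> introduces only
  one further unrestricted series, \<open>E_5\<close>. The decomposition of \<open>O_4\<close> expresses it through \<open>O_4\<close> and
  \<open>O_5\<close>, which closes the system; this is the origin of the negative term.
\<close>
lemma kr5_functional_equation:
  defines "F \<equiv> \<lambda>k. list_gf (parts_from_once (Suc k))"
  shows "F 0 = (1 + xv * fps_const qv) * F 1
     + xv ^ 2 * fps_const (qv ^ 4) * (1 + xv * fps_const (qv ^ 3)) * F 3
     - xv ^ 4 * fps_const (qv ^ 11) * F 4"
proof -
  define Q where "Q = fps_const qv"
  have Q: "fps_const (qv ^ n) = Q ^ n" for n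
    by (simp add: Q_def fps_const_power)
  define G where "G k = list_gf (parts_from (Suc k))" for k
  have once: "F k = G (Suc k) + xv * Q ^ Suc k * F (Suc k)" for k
    unfolding F_def G_def Q[symmetric] using list_gf_parts_from_once[of k] by simp
  have all: "G k = F k + xv ^ 2 * Q ^ (2 * k + 2) * F (k + 2) + xv ^ 3 * Q ^ (3 * k + 4) * G (k + 3)" for k
    using list_gf_parts_from[of k] unfolding F_def G_def Q by (simp add: eval_nat_numeral)
  have "F 0 = G 1 + xv * Q * F 1" "F 3 = G 4 + xv * Q ^ 4 * F 4"
    "G 1 = F 1 + xv ^ 2 * Q ^ 4 * F 3 + xv ^ 3 * Q ^ 7 * G 4"
    using once[of 0] once[of 3] all[of 1] by (simp_all add: eval_nat_numeral)
  thus ?thesis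
    unfolding Q Q_def[symmetric] by algebra
qed

section \<open>Sums over weighted triples\<close>

text \<open>The summation indices that contribute to the coefficient of \<open>x^m\<close>.\<close>
definition weight_triples :: "nat \<Rightarrow> (nat \<times> nat \<times> nat) set" where
  "weight_triples m = {(i, j, k). i + 2 * j + 3 * k = m}"

lemma finite_weight_triples: "finite (weight_triples m)"
  by (rule finite_subset[of _ "{..m} \<times> {..m} \<times> {..m}"]) (auto simp: weight_triples_def)

definition weight_sum :: "(nat \<Rightarrow> nat \<Rightarrow> nat \<Rightarrow> rat fps) \<Rightarrow> rat fps fps" where
  "weight_sum f = Abs_fps (\<lambda>m. \<Sum>(i, j, k) \<in> weight_triples m. f i j k)"

lemma weight_sum_diff:
  "weight_sum f - weight_sum g = weight_sum (\<lambda>i j k. f i j k - g i j k)"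
  by (simp add: weight_sum_def fps_eq_iff case_prod_unfold sum_subtractf)

lemma weight_sum_add:
  "weight_sum f + weight_sum g = weight_sum (\<lambda>i j k. f i j k + g i j k)"
  by (simp add: weight_sum_def fps_eq_iff case_prod_unfold sum.distrib)

lemma weight_sum_mult_const:
  "fps_const c * weight_sum f = weight_sum (\<lambda>i j k. c * f i j k)"
  by (simp add: weight_sum_def fps_eq_iff case_prod_unfold sum_distrib_left)

text \<open>
  A change of summation index that raises the weight by \<open>w\<close> pulls out a factor \<open>x^w\<close>, provided that
  the terms it misses vanish. It is used for the increment of each of the three indices.
\<close>
lemma weight_sum_reindex:
  assumes inj: "inj h" and weight: "\<And>t m. h t \<in> weight_triples (w + m) \<longleftrightarrow> t \<in> weight_triples m"
    and small: "\<And>t m. m < w \<Longrightarrow> h t \<notin> weight_triples m"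
    and zero: "\<And>i j k. (i, j, k) \<notin> range h \<Longrightarrow> f i j k = 0"
  shows "weight_sum f = xv ^ w * weight_sum (\<lambda>i j k. (\<lambda>(i, j, k). f i j k) (h (i, j, k)))"
proof (rule fps_ext)
  fix m
  let ?f = "\<lambda>(i, j, k). f i j k"
  show "weight_sum f $ m
      = (xv ^ w * weight_sum (\<lambda>i j k. ?f (h (i, j, k)))) $ m"
  proof (cases "m < w")
    case True
    have "?f t = 0" if "t \<in> weight_triples m" for t
      using small[OF True] zero that by (cases t) (metis (no_types, lifting) case_prod_conv rangeE)
    hence "(\<Sum>t\<in>weight_triples m. ?f t) = 0"
      by (simp add: sum.neutral)
    with True show ?thesis
      by (simp add: weight_sum_def fps_X_power_mult_nth)
  next
    case False
    then obtain m' where m': "m = w + m'"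
      by (metis le_add_diff_inverse not_less)
    have "(\<Sum>t\<in>weight_triples m. ?f t) = (\<Sum>t\<in>h ` weight_triples m'. ?f t)"
    proof (rule sum.mono_neutral_right)
      show "\<forall>t\<in>weight_triples m - h ` weight_triples m'. ?f t = 0"
      proof
        fix t assume "t \<in> weight_triples m - h ` weight_triples m'"
        hence "t \<notin> range h"
          using weight m' by auto
        thus "?f t = 0"
          using zero by (cases t) auto
      qed
    qed (use weight m' finite_weight_triples in auto)
    also have "\<dots> = (\<Sum>t\<in>weight_triples m'. ?f (h t))"
      using inj by (subst sum.reindex) (auto intro: inj_on_subset)
    finally show ?thesis
      by (simp add: m' weight_sum_def fps_X_power_mult_nth)
  qed
qed

lemma weight_sum_shift_1:
  assumes "\<And>j k. f 0 j k = 0"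
  shows "weight_sum f = xv * weight_sum (\<lambda>i j k. f (Suc i) j k)"
proof -
  have "f i j k = 0" if "(i, j, k) \<notin> range (\<lambda>(i, j, k). (Suc i, j, k))" for i j k
    using that assms by (cases i) (auto simp: image_iff)
  hence "weight_sum f = xv ^ 1 * weight_sum (\<lambda>i j k.
      (\<lambda>(i, j, k). f i j k) ((\<lambda>(i, j, k). (Suc i, j, k)) (i, j, k)))"
    by (intro weight_sum_reindex) (auto simp: inj_def weight_triples_def)
  thus ?thesis by simp
qed

lemma weight_sum_shift_2:
  assumes "\<And>i k. f i 0 k = 0"
  shows "weight_sum f = xv ^ 2 * weight_sum (\<lambda>i j k. f i (Suc j) k)"
proof -
  have "f i j k = 0" if "(i, j, k) \<notin> range (\<lambda>(i, j, k). (i, Suc j, k))" for i j k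
    using that assms by (cases j) (auto simp: image_iff)
  hence "weight_sum f = xv ^ 2 * weight_sum (\<lambda>i j k.
      (\<lambda>(i, j, k). f i j k) ((\<lambda>(i, j, k). (i, Suc j, k)) (i, j, k)))"
    by (intro weight_sum_reindex) (auto simp: inj_def weight_triples_def)
  thus ?thesis by simp
qed

lemma weight_sum_shift_3:
  assumes "\<And>i j. f i j 0 = 0"
  shows "weight_sum f = xv ^ 3 * weight_sum (\<lambda>i j k. f i j (Suc k))"
proof -
  have "f i j k = 0" if "(i, j, k) \<notin> range (\<lambda>(i, j, k). (i, j, Suc k))" for i j k
    using that assms by (cases k) (auto simp: image_iff)
  hence "weight_sum f = xv ^ 3 * weight_sum (\<lambda>i j k.
      (\<lambda>(i, j, k). f i j k) ((\<lambda>(i, j, k). (i, j, Suc k)) (i, j, k)))"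
    by (intro weight_sum_reindex) (auto simp: inj_def weight_triples_def)
  thus ?thesis by simp
qed

section \<open>The triple sum\<close>

lemma q_pochhammer_0 [simp]: "q_pochhammer a q 0 = 1"
  by (simp add: q_pochhammer_def)

lemma q_pochhammer_Suc: "q_pochhammer a q (Suc n) = q_pochhammer a q n * (1 - a * q ^ n)"
  by (simp add: q_pochhammer_def mult.commute)

lemma q_pochhammer_self_nth_0:
  "0 < d \<Longrightarrow> q_pochhammer (qv ^ d) (qv ^ d) n $ 0 = 1"
  by (induction n) (simp_all add: q_pochhammer_Suc fps_X_power_nth flip: power_mult power_add)

lemma inverse_q_pochhammer_self_Suc:
  assumes "0 < d"
  shows "(1 - qv ^ (d * Suc n)) * inverse (q_pochhammer (qv ^ d) (qv ^ d) (Suc n))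
      = inverse (q_pochhammer (qv ^ d) (qv ^ d) n)"
proof -
  have "(1 - qv ^ (d * Suc n)) $ 0 \<noteq> 0"
    using assms by (simp add: fps_X_power_nth)
  hence "(1 - qv ^ (d * Suc n)) * inverse (1 - qv ^ (d * Suc n)) = 1"
    by (rule inverse_mult_eq_1')
  moreover have "q_pochhammer (qv ^ d) (qv ^ d) (Suc n)
      = q_pochhammer (qv ^ d) (qv ^ d) n * (1 - qv ^ (d * Suc n))"
    by (simp add: q_pochhammer_Suc power_add power_mult)
  ultimately show ?thesis
    by (simp add: fps_inverse_mult mult.left_commute)
qed

text \<open>
  The summand without its power of \<open>x\<close>. The three denominators are kept apart and in the uniform
  shape \<open>(q^d; q^d)\<close>, including \<open>d = 1\<close>, so that one recursion serves all of them.
\<close>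
definition kr5_coeff :: "nat \<Rightarrow> nat \<Rightarrow> nat \<Rightarrow> rat fps" where
  "kr5_coeff i j k =
     qv ^ ((9 * k\<^sup>2 + 5 * k) div 2 + 2 * j\<^sup>2 + j + i\<^sup>2 + 6 * k * j + 3 * k * i + 2 * j * i)
     * q_pochhammer (- qv) (qv\<^sup>2) j
     * inverse (q_pochhammer (qv ^ 1) (qv ^ 1) i)
     * inverse (q_pochhammer (qv ^ 2) (qv ^ 2) j)
     * inverse (q_pochhammer (qv ^ 3) (qv ^ 3) k)"

lemma kr5_summand_eq:
  "kr5_summand i j k = fps_const (kr5_coeff i j k) * xv ^ (3 * k + 2 * j + i)"
proof -
  have "(q_pochhammer (qv ^ 1) (qv ^ 1) i * q_pochhammer (qv ^ 2) (qv ^ 2) j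
      * q_pochhammer (qv ^ 3) (qv ^ 3) k) $ 0 \<noteq> 0"
    using q_pochhammer_self_nth_0[of 1 i] q_pochhammer_self_nth_0[of 2 j]
      q_pochhammer_self_nth_0[of 3 k] by simp
  from fps_divide_unit[OF this] show ?thesis
    by (simp add: kr5_summand_def kr5_coeff_def fps_inverse_mult mult.assoc)
qed

text \<open>
  The next three lemmas are the term ratios: raising one index changes the quadratic exponent by
  a linear form and adds one factor to the Pochhammer symbols in that index.
\<close>
lemma kr5_coeff_Suc_1:
  "(1 - qv ^ Suc i) * kr5_coeff (Suc i) j k = qv ^ (2 * i + 1 + 2 * j + 3 * k) * kr5_coeff i j k"
proof -
  have exponent: "(9 * k\<^sup>2 + 5 * k) div 2 + 2 * j\<^sup>2 + j + (Suc i)\<^sup>2 + 6 * k * j +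
        3 * k * Suc i + 2 * j * Suc i
      = (2 * i + 1 + 2 * j + 3 * k)
        + ((9 * k\<^sup>2 + 5 * k) div 2 + 2 * j\<^sup>2 + j + i\<^sup>2 + 6 * k * j + 3 * k * i + 2 * j * i)"
    by (simp add: power2_eq_square)
  show ?thesis
    unfolding kr5_coeff_def exponent power_add[of qv "2 * i + 1 + 2 * j + 3 * k"]
      inverse_q_pochhammer_self_Suc[of 1 i, symmetric, simplified mult_1, OF zero_less_one]
    by (simp only: mult_ac)
qed

lemma kr5_coeff_Suc_2:
  "(1 - qv ^ (2 * Suc j)) * kr5_coeff i (Suc j) k
     = qv ^ (2 * i + 4 * j + 3 + 6 * k) * (1 + qv ^ (2 * j + 1)) * kr5_coeff i j k"
proof -
  have exponent: "(9 * k\<^sup>2 + 5 * k) div 2 + 2 * (Suc j)\<^sup>2 + Suc j + i\<^sup>2 + 6 * k * Suc j +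
        3 * k * i + 2 * Suc j * i
      = (2 * i + 4 * j + 3 + 6 * k)
        + ((9 * k\<^sup>2 + 5 * k) div 2 + 2 * j\<^sup>2 + j + i\<^sup>2 + 6 * k * j + 3 * k * i + 2 * j * i)"
    by (simp add: power2_eq_square)
  have numerator: "q_pochhammer (- qv) (qv\<^sup>2) (Suc j)
      = q_pochhammer (- qv) (qv\<^sup>2) j * (1 + qv ^ (2 * j + 1))"
    by (simp add: q_pochhammer_Suc power_mult)
  show ?thesis
    unfolding kr5_coeff_def exponent numerator power_add[of qv "2 * i + 4 * j + 3 + 6 * k"]
      inverse_q_pochhammer_self_Suc[of 2 j, symmetric, OF zero_less_numeral]
    by (simp only: mult_ac)
qed

lemma kr5_coeff_Suc_3:
  "(1 - qv ^ (3 * Suc k)) * kr5_coeff i j (Suc k)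
     = qv ^ (3 * i + 6 * j + 9 * k + 7) * kr5_coeff i j k"
proof -
  have "9 * (Suc k)\<^sup>2 + 5 * Suc k = 9 * k\<^sup>2 + 5 * k + (9 * k + 7) * 2"
    by (simp add: power2_eq_square)
  hence "(9 * (Suc k)\<^sup>2 + 5 * Suc k) div 2 = 9 * k + 7 + (9 * k\<^sup>2 + 5 * k) div 2"
    by simp
  hence exponent: "(9 * (Suc k)\<^sup>2 + 5 * Suc k) div 2 + 2 * j\<^sup>2 + j + i\<^sup>2 + 6 * Suc k * j +
        3 * Suc k * i + 2 * j * i
      = (3 * i + 6 * j + 9 * k + 7)
        + ((9 * k\<^sup>2 + 5 * k) div 2 + 2 * j\<^sup>2 + j + i\<^sup>2 + 6 * k * j + 3 * k * i + 2 * j * i)"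
    by (simp only:) (simp add: algebra_simps)
  show ?thesis
    unfolding kr5_coeff_def exponent power_add[of qv "3 * i + 6 * j + 9 * k + 7"]
      inverse_q_pochhammer_self_Suc[of 3 k, symmetric, OF zero_less_numeral]
    by (simp only: mult_ac)
qed

text \<open>
  The factors \<open>2\<close> and \<open>3\<close> in the exponent are the weights of \<open>n_2\<close> and \<open>n_3\<close>, so that the diagonal
  \<open>a = b = c = n\<close> is the substitution of \<open>x q^n\<close> for \<open>x\<close>.
\<close>
definition kr5_series :: "nat \<Rightarrow> nat \<Rightarrow> nat \<Rightarrow> rat fps fps" where
  "kr5_series a b c = weight_sum (\<lambda>i j k. qv ^ (a * i + 2 * b * j + 3 * c * k) * kr5_coeff i j k)"

text \<open>
  The difference of the two series has the summand of \<open>kr5_series a b c\<close> multiplied by \<open>1 - q^(n_1)\<close>.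
  This kills the terms with \<open>n_1 = 0\<close>, and \<open>kr5_coeff_Suc_1\<close> evaluates the others after the shift of
  \<open>n_1\<close>. The two lemmas that follow do the same with \<open>1 - q^(2 n_2)\<close> and \<open>1 - q^(3 n_3)\<close>.
\<close>
lemma kr5_series_rel_1:
  "kr5_series a b c = kr5_series (a + 1) b c
     + xv * (fps_const (qv ^ (a + 1)) * kr5_series (a + 2) (b + 1) (c + 1))"
proof -
  have term_eq: "qv ^ (a * Suc i + 2 * b * j + 3 * c * k) * kr5_coeff (Suc i) j k
        - qv ^ ((a + 1) * Suc i + 2 * b * j + 3 * c * k) * kr5_coeff (Suc i) j k
      = qv ^ (a + 1) * (qv ^ ((a + 2) * i + 2 * (b + 1) * j + 3 * (c + 1) * k) * kr5_coeff i j k)"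
    for i j k
  proof -
    have "qv ^ (a * Suc i + 2 * b * j + 3 * c * k) * kr5_coeff (Suc i) j k
        - qv ^ ((a + 1) * Suc i + 2 * b * j + 3 * c * k) * kr5_coeff (Suc i) j k
      = qv ^ (a * Suc i + 2 * b * j + 3 * c * k) * ((1 - qv ^ Suc i) * kr5_coeff (Suc i) j k)"
      by (simp add: algebra_simps power_add)
    also have "\<dots> = qv ^ (a * Suc i + 2 * b * j + 3 * c * k + (2 * i + 1 + 2 * j + 3 * k)) * kr5_coeff i j k"
      by (simp only: kr5_coeff_Suc_1 power_add mult.assoc)
    also have "a * Suc i + 2 * b * j + 3 * c * k + (2 * i + 1 + 2 * j + 3 * k)
        = (a + 1) + ((a + 2) * i + 2 * (b + 1) * j + 3 * (c + 1) * k)"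
      by (simp add: algebra_simps)
    finally show ?thesis
      by (simp only: power_add mult.assoc)
  qed
  have "kr5_series a b c - kr5_series (a + 1) b c
      = xv * (fps_const (qv ^ (a + 1)) * kr5_series (a + 2) (b + 1) (c + 1))"
    unfolding kr5_series_def weight_sum_diff weight_sum_mult_const
    by (subst weight_sum_shift_1) (simp_all only: term_eq, simp)
  thus ?thesis
    by (simp add: algebra_simps)
qed

lemma kr5_series_rel_2:
  "kr5_series a b c = kr5_series a (b + 1) c
     + xv ^ 2 * (fps_const (qv ^ (2 * b + 3)) * kr5_series (a + 2) (b + 2) (c + 2)
       + fps_const (qv ^ (2 * b + 4)) * kr5_series (a + 2) (b + 3) (c + 2))"
proof -
  have term_eq: "qv ^ (a * i + 2 * b * Suc j + 3 * c * k) * kr5_coeff i (Suc j) k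
        - qv ^ (a * i + 2 * (b + 1) * Suc j + 3 * c * k) * kr5_coeff i (Suc j) k
      = qv ^ (2 * b + 3) * (qv ^ ((a + 2) * i + 2 * (b + 2) * j + 3 * (c + 2) * k) * kr5_coeff i j k)
        + qv ^ (2 * b + 4) * (qv ^ ((a + 2) * i + 2 * (b + 3) * j + 3 * (c + 2) * k) * kr5_coeff i j k)"
    for i j k
  proof -
    have "qv ^ (a * i + 2 * b * Suc j + 3 * c * k) * kr5_coeff i (Suc j) k
        - qv ^ (a * i + 2 * (b + 1) * Suc j + 3 * c * k) * kr5_coeff i (Suc j) k
      = qv ^ (a * i + 2 * b * Suc j + 3 * c * k) * ((1 - qv ^ (2 * Suc j)) * kr5_coeff i (Suc j) k)"
      by (simp add: algebra_simps power_add)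
    also have "\<dots> = (qv ^ (a * i + 2 * b * Suc j + 3 * c * k + (2 * i + 4 * j + 3 + 6 * k))
        + qv ^ (a * i + 2 * b * Suc j + 3 * c * k + (2 * i + 4 * j + 3 + 6 * k) + (2 * j + 1))) * kr5_coeff i j k"
      by (simp only: kr5_coeff_Suc_2 power_add)
        (simp only: distrib_left distrib_right mult_1_right mult.assoc)
    also have "a * i + 2 * b * Suc j + 3 * c * k + (2 * i + 4 * j + 3 + 6 * k) + (2 * j + 1)
        = (2 * b + 4) + ((a + 2) * i + 2 * (b + 3) * j + 3 * (c + 2) * k)"
      by (simp add: algebra_simps)
    also have "a * i + 2 * b * Suc j + 3 * c * k + (2 * i + 4 * j + 3 + 6 * k)
        = (2 * b + 3) + ((a + 2) * i + 2 * (b + 2) * j + 3 * (c + 2) * k)"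
      by (simp add: algebra_simps)
    finally show ?thesis
      by (simp only: power_add distrib_right mult.assoc)
  qed
  have "kr5_series a b c - kr5_series a (b + 1) c
      = xv ^ 2 * (fps_const (qv ^ (2 * b + 3)) * kr5_series (a + 2) (b + 2) (c + 2)
       + fps_const (qv ^ (2 * b + 4)) * kr5_series (a + 2) (b + 3) (c + 2))"
    unfolding kr5_series_def weight_sum_diff weight_sum_mult_const weight_sum_add
    by (subst weight_sum_shift_2) (simp_all only: term_eq, simp)
  thus ?thesis
    by (simp add: algebra_simps)
qed

lemma kr5_series_rel_3:
  "kr5_series a b c = kr5_series a b (c + 1)
     + xv ^ 3 * (fps_const (qv ^ (3 * c + 7)) * kr5_series (a + 3) (b + 3) (c + 3))"
proof -
  have term_eq: "qv ^ (a * i + 2 * b * j + 3 * c * Suc k) * kr5_coeff i j (Suc k)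
        - qv ^ (a * i + 2 * b * j + 3 * (c + 1) * Suc k) * kr5_coeff i j (Suc k)
      = qv ^ (3 * c + 7) * (qv ^ ((a + 3) * i + 2 * (b + 3) * j + 3 * (c + 3) * k) * kr5_coeff i j k)"
    for i j k
  proof -
    have "qv ^ (a * i + 2 * b * j + 3 * c * Suc k) * kr5_coeff i j (Suc k)
        - qv ^ (a * i + 2 * b * j + 3 * (c + 1) * Suc k) * kr5_coeff i j (Suc k)
      = qv ^ (a * i + 2 * b * j + 3 * c * Suc k) * ((1 - qv ^ (3 * Suc k)) * kr5_coeff i j (Suc k))"
      by (simp add: algebra_simps power_add)
    also have "\<dots> = qv ^ (a * i + 2 * b * j + 3 * c * Suc k + (3 * i + 6 * j + 9 * k + 7)) * kr5_coeff i j k"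
      by (simp only: kr5_coeff_Suc_3 power_add mult.assoc)
    also have "a * i + 2 * b * j + 3 * c * Suc k + (3 * i + 6 * j + 9 * k + 7)
        = (3 * c + 7) + ((a + 3) * i + 2 * (b + 3) * j + 3 * (c + 3) * k)"
      by (simp add: algebra_simps)
    finally show ?thesis
      by (simp only: power_add mult.assoc)
  qed
  have "kr5_series a b c - kr5_series a b (c + 1)
      = xv ^ 3 * (fps_const (qv ^ (3 * c + 7)) * kr5_series (a + 3) (b + 3) (c + 3))"
    unfolding kr5_series_def weight_sum_diff weight_sum_mult_const
    by (subst weight_sum_shift_3) (simp_all only: term_eq, simp)
  thus ?thesis
    by (simp add: algebra_simps)
qed

lemma kr5_series_diagonal_nth:
  "kr5_series n n n $ m = qv ^ (n * m) * kr5_series 0 0 0 $ m"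
proof -
  have "qv ^ (n * i + 2 * n * j + 3 * n * k) = qv ^ (n * m)" if "(i, j, k) \<in> weight_triples m" for i j k
    using that by (auto simp: weight_triples_def algebra_simps)
  thus ?thesis
    unfolding kr5_series_def weight_sum_def
    by (auto simp: sum_distrib_left intro!: sum.cong)
qed

text \<open>
  The five instances form a path from \<open>U(0, 0, 0)\<close> to the diagonal: the parameters \<open>c\<close>, \<open>a\<close>, \<open>b\<close> are
  raised in this order to reach \<open>U(1, 1, 1)\<close>. The first and the last step leave multiples of the
  diagonal term \<open>U(3, 3, 3)\<close>, but also \<open>U(2, 1, 2)\<close> and \<open>U(3, 2, 3)\<close> appear. The relation that
  raises \<open>a\<close> in \<open>U(1, 1, 2)\<close> trades these two for \<open>U(1, 1, 2)\<close>, which the last relation connects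
  to \<open>U(1, 1, 1)\<close> and \<open>U(4, 4, 4)\<close>.
\<close>
lemma kr5_series_functional_equation:
  defines "F \<equiv> \<lambda>n. kr5_series n n n"
  shows "F 0 = (1 + xv * fps_const qv) * F 1
     + xv ^ 2 * fps_const (qv ^ 4) * (1 + xv * fps_const (qv ^ 3)) * F 3
     - xv ^ 4 * fps_const (qv ^ 11) * F 4"
proof -
  define Q where "Q = fps_const qv"
  have Q: "fps_const (qv ^ n) = Q ^ n" for n
    by (simp add: Q_def fps_const_power)
  note rels = kr5_series_rel_1[unfolded Q] kr5_series_rel_2[unfolded Q] kr5_series_rel_3[unfolded Q]
  have "F 0 = kr5_series 0 0 1 + xv ^ 3 * (Q ^ 7 * F 3)"
    using rels(3)[of 0 0 0] by (simp add: F_def)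
  moreover have "kr5_series 0 0 1 = kr5_series 1 0 1 + xv * (Q * kr5_series 2 1 2)"
    using rels(1)[of 0 0 1] by (simp add: numeral_2_eq_2)
  moreover have "kr5_series 1 0 1 = F 1 + xv ^ 2 * (Q ^ 3 * kr5_series 3 2 3 + Q ^ 4 * F 3)"
    using rels(2)[of 1 0 1] by (simp add: F_def eval_nat_numeral)
  moreover have "kr5_series 1 1 2 = kr5_series 2 1 2 + xv * (Q ^ 2 * kr5_series 3 2 3)"
    using rels(1)[of 1 1 2] by (simp add: eval_nat_numeral)
  moreover have "F 1 = kr5_series 1 1 2 + xv ^ 3 * (Q ^ 10 * F 4)"
    using rels(3)[of 1 1 1] by (simp add: F_def eval_nat_numeral)
  ultimately show ?thesis
    unfolding Q Q_def[symmetric] by algebra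
qed

section \<open>Uniqueness\<close>

text \<open>
  The equation is linear, so uniqueness of its solution is stated for the difference of two
  solutions. The family \<open>H n\<close> plays the role of \<open>H(x q^n)\<close>.
\<close>
lemma functional_equation_zero:
  fixes H :: "nat \<Rightarrow> rat fps fps"
  assumes shift: "\<And>n m. H n $ m = qv ^ (n * m) * H 0 $ m"
    and eq: "H 0 = (1 + xv * fps_const qv) * H 1
     + xv ^ 2 * fps_const (qv ^ 4) * (1 + xv * fps_const (qv ^ 3)) * H 3
     - xv ^ 4 * fps_const (qv ^ 11) * H 4"
    and init: "H 0 $ 0 = 0"
  shows "H 0 = 0"
proof -
  have eq': "H 0 = H 1 + xv ^ 1 * (fps_const qv * H 1) + xv ^ 2 * (fps_const (qv ^ 4) * H 3)
      + xv ^ 3 * (fps_const (qv ^ 4) * fps_const (qv ^ 3) * H 3) - xv ^ 4 * (fps_const (qv ^ 11) * H 4)"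
    by (subst eq) (simp add: algebra_simps power2_eq_square power3_eq_cube)
  have "H 0 $ m = 0" for m
  proof (induction m rule: less_induct)
    case (less m)
    show ?case
    proof (cases "m = 0")
      case False
      \<comment> \<open>All terms on the right with a positive power of \<open>x\<close> involve earlier coefficients only.\<close>
      have lower: "(xv ^ Suc d * (fps_const c * H n)) $ m = 0" for d c n
        using less[of "m - Suc d"] False
        by (simp add: fps_X_power_mult_nth shift[of n] del: power_Suc)
      have "H 0 $ m = H 1 $ m"
        using arg_cong[OF eq', of "\<lambda>f. f $ m"]
          lower[of 0 qv 1] lower[of 1 "qv ^ 4" 3] lower[of 2 "qv ^ 4 * qv ^ 3" 3] lower[of 3 "qv ^ 11" 4]
        by (simp add: eval_nat_numeral)
      hence "(1 - qv ^ m) * H 0 $ m = 0"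
        using shift[of 1 m] by (simp add: left_diff_distrib)
      moreover have "(1 - qv ^ m) $ 0 \<noteq> 0"
        using False by (simp add: fps_X_power_nth)
      hence "1 - qv ^ m \<noteq> 0"
        by (metis fps_zero_nth)
      ultimately show ?thesis
        by simp
    qed (use init in simp)
  qed
  thus ?thesis
    by (simp add: fps_eq_iff)
qed

lemma kr5_gf_eq_kr5_series: "kr5_gf = kr5_series 0 0 0"
proof -
  define H where "H n = list_gf (parts_from_once (Suc n)) - kr5_series n n n" for n
  have "H 0 = 0"
  proof (rule functional_equation_zero)
    show "H n $ m = qv ^ (n * m) * H 0 $ m" for n m
      using list_gf_parts_from_once_nth[of n m] kr5_series_diagonal_nth[of n m]
      by (simp add: H_def right_diff_distrib)
    show "H 0 = (1 + xv * fps_const qv) * H 1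
     + xv ^ 2 * fps_const (qv ^ 4) * (1 + xv * fps_const (qv ^ 3)) * H 3
     - xv ^ 4 * fps_const (qv ^ 11) * H 4"
      using kr5_functional_equation kr5_series_functional_equation
      unfolding H_def by algebra
    have "{xs \<in> parts_from_once 1. length xs = 0 \<and> sum_list xs = n} = (if n = 0 then {[]} else {})" for n
      by (auto simp: parts_from_once_def Nil_in_parts_from)
    hence "list_gf (parts_from_once 1) $ 0 = 1"
      by (simp add: list_gf_def fps_eq_iff)
    moreover have "weight_triples 0 = {(0, 0, 0)}"
      by (auto simp: weight_triples_def)
    hence "kr5_series 0 0 0 $ 0 = 1"
      by (simp add: kr5_series_def weight_sum_def kr5_coeff_def)
    ultimately show "H 0 $ 0 = 0"
      by (simp add: H_def)
  qed
  thus ?thesis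
    by (simp add: H_def kr5_gf_eq_list_gf)
qed

text \<open>
  Convergence in the \<open>x\<close>-adic topology is coefficientwise stabilisation, and the coefficient of
  \<open>x^m\<close> is final as soon as the finitely many triples of weight \<open>m\<close> have been summed.
\<close>
lemma has_sum_weight_sum:
  "((\<lambda>(i, j, k). fps_const (f i j k) * xv ^ (3 * k + 2 * j + i)) has_sum weight_sum f) UNIV"
  unfolding has_sum_def
proof (rule tendsto_fpsI)
  fix m
  show "\<forall>\<^sub>F T in finite_subsets_at_top UNIV.
    (\<Sum>(i, j, k)\<in>T. fps_const (f i j k) * xv ^ (3 * k + 2 * j + i)) $ m = weight_sum f $ m"
    unfolding eventually_finite_subsets_at_top
  proof (intro exI[of _ "weight_triples m"] conjI allI impI finite_weight_triples subset_UNIV)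
    fix T assume T: "finite T \<and> weight_triples m \<subseteq> T \<and> T \<subseteq> UNIV"
    have "(\<Sum>(i, j, k)\<in>T. fps_const (f i j k) * xv ^ (3 * k + 2 * j + i)) $ m
        = (\<Sum>t\<in>T. if t \<in> weight_triples m then (\<lambda>(i, j, k). f i j k) t else 0)"
      unfolding fps_sum_nth
      by (intro sum.cong) (auto simp: weight_triples_def fps_X_power_nth)
    also have "\<dots> = (\<Sum>t\<in>weight_triples m. (\<lambda>(i, j, k). f i j k) t)"
      using T by (simp add: sum.If_cases Int_absorb1 Int_commute)
    finally show "(\<Sum>(i, j, k)\<in>T. fps_const (f i j k) * xv ^ (3 * k + 2 * j + i)) $ m = weight_sum f $ m"
      by (simp add: weight_sum_def)
  qed
qed

theorem theorem14:
  shows "((\<lambda>(n1, n2, n3). kr5_summand n1 n2 n3) has_sum kr5_gf) UNIV"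
proof -
  have "kr5_gf = weight_sum kr5_coeff"
    by (simp add: kr5_gf_eq_kr5_series kr5_series_def)
  thus ?thesis
    using has_sum_weight_sum[of kr5_coeff] by (simp add: kr5_summand_eq)
qed

end
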